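(* Let $n = 2k$, where $k\ge 6$ is an integer. There exists a closed-twin-free graph of order $n$ with $\binom{2k}{2}-(k+2)$ edges that contains a proper-min-forced vertex.
   Context: All graphs are simple, finite and undirected; the order of a graph is its number of vertices. $N[v]$ is the closed neighbourhood of a vertex $v$. Distinct vertices $u,v$ are closed twins if $N[u]=N[v]$; a graph is closed-twin-free if it has no closed twins. A nonempty set $S\subseteq V(G)$ is called a code; for $v\in V(G)$ let $I(S;v)=S\cap N[v]$. A code $S$ is an identifying code in $G$ if $I(S;v)\neq\emptyset$ for all $v\in V(G)$ and $I(S;u)\neq I(S;v)$ for all distinct $u,v\in V(G)$. A minimum identifying code is an identifying code of the smallest cardinality. In a closed-twin-free graph $G$, a vertex is always-forced if it belongs to every identifying code in $G$; it is min-forced if it belongs to every minimum identifying code in $G$; it is proper-min-forced if it is min-forced but not always-forced. *)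

theory Defs
  imports Complex_Main "Graph_Theory.Pair_Digraph"
begin

text \<open>
  A finite simple undirected graph is a \<^locale>\<open>pair_graph\<close>: a finite vertex set with a
  finite, symmetric and irreflexive arc relation. Every undirected edge is thus represented by two
  opposite arcs; \<open>uedges\<close> counts it once.
\<close>

definition uedges :: "'a pair_pre_digraph \<Rightarrow> 'a set set" where
  "uedges G = (\<lambda>(u, v). {u, v}) ` parcs G"

definition closed_nbhd :: "'a pair_pre_digraph \<Rightarrow> 'a \<Rightarrow> 'a set" where
  "closed_nbhd G v = insert v {u. (v, u) \<in> parcs G}"

definition closed_twins :: "'a pair_pre_digraph \<Rightarrow> 'a \<Rightarrow> 'a \<Rightarrow> bool" where
  "closed_twins G u v \<longleftrightarrow>
     u \<in> pverts G \<and> v \<in> pverts G \<and> u \<noteq> v \<and> closed_nbhd G u = closed_nbhd G v"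

definition closed_twin_free :: "'a pair_pre_digraph \<Rightarrow> bool" where
  "closed_twin_free G \<longleftrightarrow> \<not> (\<exists>u v. closed_twins G u v)"

definition code :: "'a pair_pre_digraph \<Rightarrow> 'a set \<Rightarrow> bool" where
  "code G S \<longleftrightarrow> S \<noteq> {} \<and> S \<subseteq> pverts G"

definition I_set :: "'a pair_pre_digraph \<Rightarrow> 'a set \<Rightarrow> 'a \<Rightarrow> 'a set" where
  "I_set G S v = S \<inter> closed_nbhd G v"

definition identifying_code :: "'a pair_pre_digraph \<Rightarrow> 'a set \<Rightarrow> bool" where
  "identifying_code G S \<longleftrightarrow> code G S \<and>
     (\<forall>v \<in> pverts G. I_set G S v \<noteq> {}) \<and>
     (\<forall>u \<in> pverts G. \<forall>v \<in> pverts G. u \<noteq> v \<longrightarrow> I_set G S u \<noteq> I_set G S v)"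

definition minimum_identifying_code :: "'a pair_pre_digraph \<Rightarrow> 'a set \<Rightarrow> bool" where
  "minimum_identifying_code G S \<longleftrightarrow>
     identifying_code G S \<and> (\<forall>T. identifying_code G T \<longrightarrow> card S \<le> card T)"

text \<open>
  The following three notions are meant for closed-twin-free graphs only: a graph with closed twins
  has no identifying code, so that all its vertices would be forced vacuously.
\<close>

definition always_forced :: "'a pair_pre_digraph \<Rightarrow> 'a \<Rightarrow> bool" where
  "always_forced G v \<longleftrightarrow> v \<in> pverts G \<and> (\<forall>S. identifying_code G S \<longrightarrow> v \<in> S)"

definition min_forced :: "'a pair_pre_digraph \<Rightarrow> 'a \<Rightarrow> bool" where
  "min_forced G v \<longleftrightarrow> v \<in> pverts G \<and> (\<forall>S. minimum_identifying_code G S \<longrightarrow> v \<in> S)"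

definition proper_min_forced :: "'a pair_pre_digraph \<Rightarrow> 'a \<Rightarrow> bool" where
  "proper_min_forced G v \<longleftrightarrow> min_forced G v \<and> \<not> always_forced G v"

end

theory Submission
  imports Defs
begin

text \<open>
  The graph is given by its complement: a bull (the triangle 0, 1, 2 with a pendant vertex 3 at 0
  and a pendant vertex 4 at 1), the isolated vertex 5 and \<open>k - 3\<close> disjoint edges. In terms of the
  complement, a code separates two vertices iff it meets their open neighbourhoods in different
  sets. As 5 has no neighbours there, the neighbourhood of every other vertex has to be met, which
  forces 0, 1 and both ends of the disjoint edges. What remains is to separate 0 from 4 and 1 from
  3: either the vertex 2 does both, or 3 and 4 are both needed. So 2 lies in the unique minimum
  identifying code, but not in all identifying codes.
\<close>

definition mate :: "nat \<Rightarrow> nat" where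
  "mate v = (if even v then v + 1 else v - 1)"

text \<open>Open neighbourhoods in the complement. They do not depend on \<open>k\<close>: for
  \<open>k > 2\<close> the complement is a union of components of one infinite graph.\<close>

definition co_nbhd :: "nat \<Rightarrow> nat set" where
  "co_nbhd v =
     (if v = 0 then {1, 2, 3} else if v = 1 then {0, 2, 4} else if v = 2 then {0, 1}
      else if v = 3 then {0} else if v = 4 then {1} else if v = 5 then {} else {mate v})"

definition co_bull_graph :: "nat \<Rightarrow> nat pair_pre_digraph" where
  "co_bull_graph k = \<lparr>pverts = {..<2 * k},
     parcs = {(u, v). u < 2 * k \<and> v < 2 * k \<and> u \<noteq> v \<and> v \<notin> co_nbhd u}\<rparr>"

lemma mate_mate: "mate (mate v) = v"
  by (auto simp: mate_def)

lemma mate_neq: "mate v \<noteq> v"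
  by (auto simp: mate_def elim: oddE)

text \<open>The bound is even, so it splits no pair \<open>2 * i\<close>,
  \<open>2 * i + 1\<close>.\<close>

lemma mate_less_iff: "mate v < 2 * k \<longleftrightarrow> v < 2 * k"
  unfolding mate_def by presburger

lemma mate_ge_6_iff: "6 \<le> mate v \<longleftrightarrow> 6 \<le> v"
  unfolding mate_def by presburger

lemma co_nbhd_simps [simp]:
  "co_nbhd 0 = {1, 2, 3}" "co_nbhd (Suc 0) = {0, 2, 4}" "co_nbhd 2 = {0, 1}"
  "co_nbhd 3 = {0}" "co_nbhd 4 = {1}" "co_nbhd 5 = {}" "6 \<le> v \<Longrightarrow> co_nbhd v = {mate v}"
  by (auto simp: co_nbhd_def)

lemma vertex_cases:
  fixes v :: nat
  obtains "v = 0" | "v = Suc 0" | "v = 2" | "v = 3" | "v = 4" | "v = 5" | "6 \<le> v"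
  by force

lemma not_in_co_nbhd_self: "v \<notin> co_nbhd v"
  using mate_neq[of v] by (cases v rule: vertex_cases) auto

lemma co_nbhd_sym: "u \<in> co_nbhd v \<longleftrightarrow> v \<in> co_nbhd u"
  using mate_mate[of u] mate_mate[of v] mate_ge_6_iff[of u] mate_ge_6_iff[of v]
  by (cases u rule: vertex_cases; cases v rule: vertex_cases) auto

lemma pair_graph_co_bull_graph: "pair_graph (co_bull_graph k)"
proof
  show "finite (parcs (co_bull_graph k))"
    by (rule finite_subset[of _ "{..<2 * k} \<times> {..<2 * k}"]) (auto simp: co_bull_graph_def)
  show "symmetric (with_proj (co_bull_graph k))"
    by (auto simp: symmetric_def sym_def arcs_ends_def arc_to_ends_def co_bull_graph_def co_nbhd_sym)
qed (auto simp: co_bull_graph_def)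

lemma pverts_co_bull_graph [simp]: "pverts (co_bull_graph k) = {..<2 * k}"
  by (simp add: co_bull_graph_def)

text \<open>A closed neighbourhood consists of all vertices outside the open neighbourhood in the
  complement. This turns every question about codes into one about \<open>co_nbhd\<close>.\<close>

lemma I_set_co_bull_graph:
  assumes "S \<subseteq> {..<2 * k}" "v < 2 * k"
  shows "I_set (co_bull_graph k) S v = S - co_nbhd v"
  using assms not_in_co_nbhd_self[of v]
  by (auto simp: I_set_def closed_nbhd_def co_bull_graph_def)

lemma identifying_code_co_bull_graph:
  assumes "k > 3"
  shows "identifying_code (co_bull_graph k) S \<longleftrightarrow>
    S \<subseteq> {..<2 * k} \<and> {0, 1} \<union> {6..<2 * k} \<subseteq> S \<and> (2 \<in> S \<or> {3, 4} \<subseteq> S)"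
    (is "?code \<longleftrightarrow> ?R")
proof
  assume code: ?code
  then have S: "S \<subseteq> {..<2 * k}"
    by (simp add: identifying_code_def code_def)
  have sep: "S \<inter> co_nbhd u \<noteq> S \<inter> co_nbhd v" if "u < 2 * k" "v < 2 * k" "u \<noteq> v" for u v
  proof -
    have "S - co_nbhd u \<noteq> S - co_nbhd v"
      using code that by (simp add: identifying_code_def flip: I_set_co_bull_graph[OF S])
    then show ?thesis by blast
  qed
  \<comment> \<open>\<open>co_nbhd (mate v)\<close> is \<open>{v}\<close> and
    \<open>co_nbhd 5\<close> is empty, so only \<open>v\<close> can separate \<open>mate v\<close>
    from 5.\<close>
  have "v \<in> S" if "6 \<le> v" "v < 2 * k" for v
    using sep[of "mate v" 5] that assms mate_ge_6_iff[of v] mate_less_iff[of v k]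
    by (auto simp: mate_mate)
  moreover have "0 \<in> S" "1 \<in> S"
    using sep[of 3 5] sep[of 4 5] assms by auto
  \<comment> \<open>The sets \<open>{1, 2, 3}\<close> and \<open>{1}\<close> differ in 2 and 3, the
    sets \<open>{0, 2, 4}\<close> and \<open>{0}\<close> in 2 and 4.\<close>
  moreover have "2 \<in> S \<or> 3 \<in> S" "2 \<in> S \<or> 4 \<in> S"
    using sep[of 0 4] sep[of "Suc 0" 3] assms by auto
  ultimately show ?R
    using S by auto
next
  assume R: ?R
  then have S: "S \<subseteq> {..<2 * k}" by simp
  have in_S: "0 \<in> S" "Suc 0 \<in> S" "6 \<in> S" "7 \<in> S" "2 \<in> S \<or> 3 \<in> S \<and> 4 \<in> S"
    using R assms by auto
  have mate_in_S: "mate v \<in> S" if "6 \<le> v" "v < 2 * k" for v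
    using R that mate_ge_6_iff[of v] mate_less_iff[of v k] by auto
  have mate_neq_small: "mate v \<noteq> 0" "mate v \<noteq> Suc 0" "mate v \<noteq> 2" "mate v \<noteq> 3" "mate v \<noteq> 4"
    if "6 \<le> v" for v
    using mate_ge_6_iff[of v] that by auto
  \<comment> \<open>The code element 6 survives for every \<open>v\<close> below 6, and 0 survives
    for every other \<open>v\<close>.\<close>
  have nonempty: "S - co_nbhd v \<noteq> {}" for v
  proof (cases v rule: vertex_cases)
    assume "6 \<le> v"
    then show ?thesis using in_S mate_neq_small[of v] by auto
  qed (use in_S in auto)
  have sep: "S \<inter> co_nbhd u \<noteq> S \<inter> co_nbhd v" if "u < 2 * k" "v < 2 * k" "u \<noteq> v" for u v
  proof
    assume "S \<inter> co_nbhd u = S \<inter> co_nbhd v"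
    then have eq: "x \<in> co_nbhd u \<longleftrightarrow> x \<in> co_nbhd v" if "x \<in> S" for x
      using that by blast
    \<comment> \<open>By symmetry \<open>v\<close> lies in \<open>co_nbhd (mate u)\<close>, which is
      \<open>{u}\<close>. Hence the code element \<open>mate u\<close> separates \<open>u\<close>
      from every other vertex.\<close>
    have *: "v = u" if "6 \<le> u" "u < 2 * k" "mate u \<in> co_nbhd v" for u v
      using that co_nbhd_sym[of "mate u" v] mate_ge_6_iff[of u] by (simp add: mate_mate)
    consider "6 \<le> u" | "6 \<le> v" | "u < 6" "v < 6"
      by linarith
    then show False
    proof cases
      case 1
      with that eq[OF mate_in_S[of u]] *[of u v] show False by simp
    next
      case 2
      with that eq[OF mate_in_S[of v]] *[of v u] show False by simp
    next
      \<comment> \<open>The traces of \<open>co_nbhd\<close> on \<open>{0, 1}\<close> for the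
        vertices 0 to 5 are \<open>{1}\<close>, \<open>{0}\<close>, \<open>{0, 1}\<close>,
        \<open>{0}\<close>, \<open>{1}\<close>, \<open>{}\<close>. Only the pairs 0, 4 and 1, 3
        agree; the last part of \<open>in_S\<close> separates them.\<close>
      case 3
      then show False
        using \<open>u \<noteq> v\<close> in_S eq[of 0] eq[of "Suc 0"] eq[of 2] eq[of 3] eq[of 4]
        by (cases u rule: vertex_cases; cases v rule: vertex_cases; simp; blast?)
    qed
  qed
  show ?code
    unfolding identifying_code_def
  proof (intro conjI ballI impI)
    show "code (co_bull_graph k) S"
      using S in_S by (auto simp: code_def)
    show "I_set (co_bull_graph k) S v \<noteq> {}" if "v \<in> pverts (co_bull_graph k)" for v
      using that nonempty by (simp add: I_set_co_bull_graph[OF S])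
    show "I_set (co_bull_graph k) S u \<noteq> I_set (co_bull_graph k) S v"
      if "u \<in> pverts (co_bull_graph k)" "v \<in> pverts (co_bull_graph k)" "u \<noteq> v" for u v
      using that sep[of u v] by (auto simp: I_set_co_bull_graph[OF S])
  qed
qed

lemma identifying_code_imp_closed_twin_free:
  assumes "identifying_code G S"
  shows "closed_twin_free G"
  using assms by (auto simp: identifying_code_def closed_twin_free_def closed_twins_def I_set_def)

lemma proper_min_forced_co_bull_graph:
  assumes "k > 3"
  shows "proper_min_forced (co_bull_graph k) 2"
proof -
  note code_iff = identifying_code_co_bull_graph[OF assms]
  \<comment> \<open>\<open>?M\<close> and \<open>?N\<close> are the least codes with and without 2.
    Trading 2 for 3 and 4 costs one element, and \<open>?N\<close> shows that 2 is not
    always-forced.\<close>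
  let ?M = "insert 2 ({0, 1} \<union> {6..<2 * k})"
  let ?N = "{3, 4} \<union> ({0, 1} \<union> {6..<2 * k})"
  have M: "identifying_code (co_bull_graph k) ?M" and N: "identifying_code (co_bull_graph k) ?N"
    using assms by (auto simp: code_iff)
  have card_less: "card ?M < card ?N"
    by simp
  have "2 \<in> S" if "minimum_identifying_code (co_bull_graph k) S" for S
  proof (rule ccontr)
    assume "2 \<notin> S"
    with that have "?N \<subseteq> S" "S \<subseteq> {..<2 * k}"
      by (auto simp: minimum_identifying_code_def code_iff)
    then have "card ?N \<le> card S"
      by (meson card_mono finite_lessThan finite_subset)
    also have "card S \<le> card ?M"
      using that M unfolding minimum_identifying_code_def by blast
    finally show False
      using card_less by simp
  qed
  moreover have "2 \<notin> ?N" by simp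
  ultimately show ?thesis
    using N assms by (auto simp: proper_min_forced_def min_forced_def always_forced_def)
qed

text \<open>The complement has the five edges of the bull, collected in \<open>B\<close>, and the
  \<open>k - 3\<close> disjoint edges in \<open>P\<close>. Both lie among the pairs in
  \<open>E\<close>, so the subtraction is not truncated.\<close>

lemma card_uedges_co_bull_graph:
  assumes "k > 3"
  shows "card (uedges (co_bull_graph k)) = ((2 * k) choose 2) - (k + 2)"
proof -
  define B :: "nat set set" where "B = {{0, 1}, {0, 2}, {1, 2}, {0, 3}, {1, 4}}"
  define P :: "nat set set" where "P = (\<lambda>i. {2 * i, 2 * i + 1}) ` {3..<k}"
  define E :: "nat set set" where "E = {e. e \<subseteq> {..<2 * k} \<and> card e = 2}"
  have inj: "inj_on (\<lambda>i::nat. {2 * i, 2 * i + 1}) {3..<k}"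
    by (rule inj_onI) (auto simp: doubleton_eq_iff)
  have P_iff: "{u, v} \<in> P \<longleftrightarrow> v = mate u" if "6 \<le> u" "u < 2 * k" for u v
  proof
    assume "{u, v} \<in> P"
    then show "v = mate u"
      by (auto simp: P_def doubleton_eq_iff mate_def)
  next
    assume v: "v = mate u"
    have "{u, v} = {2 * (u div 2), 2 * (u div 2) + 1}"
      unfolding v mate_def by (cases "even u") (auto elim!: evenE oddE)
    moreover have "u div 2 \<in> {3..<k}"
      using that by auto
    ultimately show "{u, v} \<in> P"
      unfolding P_def by blast
  qed
  have P_large: "x \<ge> 6" if "e \<in> P" "x \<in> e" for e x
    using that by (auto simp: P_def)
  have B_small: "x < 5" if "e \<in> B" "x \<in> e" for e x
    using that by (auto simp: B_def)
  \<comment> \<open>Members of \<open>B\<close> stay below 5 and those of \<open>P\<close> start at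
    6, so the size of \<open>u\<close> decides which family is relevant.\<close>
  have co_edge_iff: "{u, v} \<in> B \<union> P \<longleftrightarrow> v \<in> co_nbhd u" if "u < 2 * k" for u v
  proof (cases "6 \<le> u")
    case True
    then show ?thesis
      using P_iff[of u v] that B_small[of "{u, v}" u] by auto
  next
    case False
    then have "{u, v} \<notin> P"
      using P_large[of "{u, v}" u] by auto
    moreover have "{u, v} \<in> B \<longleftrightarrow> v \<in> co_nbhd u"
      using False by (cases u rule: vertex_cases) (auto simp: B_def doubleton_eq_iff)
    ultimately show ?thesis by simp
  qed
  have "uedges (co_bull_graph k) = E - (B \<union> P)"
  proof (intro set_eqI iffI)
    fix e assume "e \<in> uedges (co_bull_graph k)"
    then obtain u v where "e = {u, v}" "u < 2 * k" "v < 2 * k" "u \<noteq> v" "v \<notin> co_nbhd u"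
      by (auto simp: uedges_def co_bull_graph_def)
    then show "e \<in> E - (B \<union> P)"
      using co_edge_iff[of u v] by (simp add: E_def)
  next
    fix e assume e: "e \<in> E - (B \<union> P)"
    then obtain u v where uv: "e = {u, v}" "u \<noteq> v"
      by (auto simp: E_def card_2_iff)
    then have "(u, v) \<in> parcs (co_bull_graph k)"
      using e co_edge_iff[of u v] by (auto simp: E_def co_bull_graph_def)
    then show "e \<in> uedges (co_bull_graph k)"
      unfolding uedges_def uv by force
  qed
  moreover have "B \<union> P \<subseteq> E"
    using assms by (auto simp: B_def P_def E_def)
  moreover have "finite (B \<union> P)"
    by (simp add: B_def P_def)
  moreover have "card (B \<union> P) = k + 2"
  proof -
    have "e \<notin> P" if "e \<in> B" for e
    proof
      assume "e \<in> P"
      moreover have "e \<noteq> {}"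
        using that by (auto simp: B_def)
      then obtain x where "x \<in> e" by blast
      ultimately show False
        using B_small[of e x] P_large[of e x] that by simp
    qed
    then have "B \<inter> P = {}" by blast
    moreover have "card B = 5"
      by (simp add: B_def doubleton_eq_iff)
    moreover have "card P = k - 3"
      unfolding P_def using card_image[OF inj] by simp
    ultimately show ?thesis
      using assms \<open>finite (B \<union> P)\<close> by (simp add: card_Un_disjoint)
  qed
  moreover have "card E = (2 * k) choose 2"
    unfolding E_def using n_subsets[of "{..<2 * k}" 2] by simp
  ultimately show ?thesis
    by (simp add: card_Diff_subset)
qed

theorem theorem15:
  fixes n k :: nat
  assumes "n = 2 * k" and "k \<ge> 6"
  shows "\<exists>G :: nat pair_pre_digraph.
           pair_graph G \<and> closed_twin_free G \<and> card (pverts G) = n \<and>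
           card (uedges G) = ((2 * k) choose 2) - (k + 2) \<and>
           (\<exists>v. proper_min_forced G v)"
proof -
  have k: "k > 3"
    using assms by simp
  \<comment> \<open>Closed twins would have equal \<open>I_set\<close> for every code, so a single
    identifying code excludes them.\<close>
  have "identifying_code (co_bull_graph k) {..<2 * k}"
    using k by (auto simp: identifying_code_co_bull_graph)
  then have "closed_twin_free (co_bull_graph k)"
    by (rule identifying_code_imp_closed_twin_free)
  with k show ?thesis
    using pair_graph_co_bull_graph card_uedges_co_bull_graph proper_min_forced_co_bull_graph
      assms(1) by (intro exI[of _ "co_bull_graph k"]) auto
qed

end
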